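(* (i) There exists a completely monotone sequence $f=\{f(n)\}_{n\ge0}$ of nonnegative real numbers such that, for real $\alpha>0$, the sequence $f^\alpha=\{f(n)^\alpha\}_{n\ge0}$ is a completely monotone sequence if and only if $\alpha\in\mathbb N$. (ii) There exists a completely monotone function $g:(0,\infty)\to[0,\infty)$ such that, for real $\alpha>0$, the function $g^\alpha$ is completely monotone if and only if $\alpha\in\mathbb N$.
   Context: A function $g:(0,\infty)\to[0,\infty)$ is completely monotone if it has derivatives of all orders and $\left(-\frac{d}{dx}\right)^n g(x)\ge0$ for all $x>0$ and $n=0,1,2,\ldots$. A sequence $a=\{a_n\}_{n\ge0}$ of real numbers is completely monotone if $((-D)^k a)_j\ge0$ for all integers $k,j\ge0$, where $D b$ is the sequence $\{b_{n+1}-b_n\}_{n\ge0}$ for a sequence $b=\{b_n\}_{n\ge0}$. *)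

theory Defs
  imports "HOL-Analysis.Analysis"
begin

definition forward_diff :: "(nat \<Rightarrow> real) \<Rightarrow> nat \<Rightarrow> real" where
  "forward_diff b = (\<lambda>n. b (Suc n) - b n)"

definition completely_monotone_seq :: "(nat \<Rightarrow> real) \<Rightarrow> bool" where
  "completely_monotone_seq a \<longleftrightarrow>
     (\<forall>k j. ((\<lambda>b n. - forward_diff b n) ^^ k) a j \<ge> 0)"

(* A function on the positive half-line is represented by a total function on the reals.
   As {0<..} is open, iterated derivatives at x > 0 depend only on the values on {0<..},
   so the values at x <= 0 are irrelevant. *)
definition completely_monotone_fun :: "(real \<Rightarrow> real) \<Rightarrow> bool" where
  "completely_monotone_fun g \<longleftrightarrow>
     (\<forall>n. \<forall>x>0. (deriv ^^ n) g field_differentiable (at x)) \<and>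
     (\<forall>n. \<forall>x>0. ((\<lambda>h x. - deriv h x) ^^ n) g x \<ge> 0)"

end

theory Submission
  imports Defs
begin

text \<open>
  The witnesses are \<open>f n = 1 + (1/2) ^ (n + 1)\<close> and \<open>g x = 1 + exp (- x)\<close>. The binomial
  series turns their \<open>\<alpha>\<close>-th powers into superpositions of decaying exponentials: the
  coefficient of \<open>exp (- k x)\<close> in \<open>g x powr \<alpha>\<close> is \<open>\<alpha> gchoose k\<close>, and the coefficient of
  \<open>((1/2) ^ k) ^ n\<close> in \<open>f n powr \<alpha>\<close> is \<open>(\<alpha> gchoose k) * (1/2) ^ k\<close>. A single exponential is
  completely monotone, so such a superposition is completely monotone if all its coefficients
  are nonnegative. The point is that the converse holds as well. If \<open>\<alpha>\<close> is not an integer,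
  then \<open>\<alpha> gchoose k\<close> is negative as soon as exactly one factor of the falling product
  \<open>\<alpha> (\<alpha> - 1) \<dots> (\<alpha> - k + 1)\<close> is negative, whereas for a natural number \<open>\<alpha>\<close> all the coefficients
  are ordinary binomial coefficients. Hence the powers are completely monotone for
  \<open>\<alpha> \<in> \<nat>\<close> only.

  The converse follows in general from the existence and uniqueness of representing measures
  (theorems of Hausdorff and Bernstein), but has an elementary proof here. The inequalities that define
  complete monotonicity test the coefficients \<open>c k\<close> against a family of weights: the differences
  give \<open>(\<Sum>k. c k * (x k) ^ j * (1 - x k) ^ i) \<ge> 0\<close> with \<open>x k = (1/2) ^ k\<close>, and the derivatives
  give \<open>(\<Sum>k. c k * k ^ n * exp (- k x)) \<ge> 0\<close>. Choosing \<open>j\<close> and \<open>i\<close> (or \<open>n\<close> and \<open>x\<close>) proportional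
  to \<open>N\<close> in a suitable ratio makes the weight the \<open>N\<close>-th power of a weight that has its unique
  maximum at a prescribed index \<open>m\<close>. After normalisation and \<open>N \<longrightarrow> \<infinity>\<close> only \<open>c m\<close> survives, so
  \<open>c m \<ge> 0\<close> (lemma \<open>coefficient_nonneg_by_localization\<close>).
\<close>

section \<open>Isolating one coefficient of a series\<close>

text \<open>
  After division by \<open>p m ^ N\<close>, the weights of all indices other than \<open>m\<close> tend to zero, and
  dominated convergence (Tannery's theorem) identifies the limit of the nonnegative sums
  as \<open>c m\<close>.
\<close>

lemma coefficient_nonneg_by_localization:
  fixes c p :: "nat \<Rightarrow> real"
  assumes summable: "summable (\<lambda>k. \<bar>c k\<bar> * p k)"
    and p_nonneg: "\<And>k. 0 \<le> p k" and p_pos: "0 < p m"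
    and p_max: "\<And>k. k \<noteq> m \<Longrightarrow> p k < p m"
    and nonneg: "\<And>N. N > 0 \<Longrightarrow> 0 \<le> (\<Sum>k. c k * p k ^ N)"
  shows "0 \<le> c m"
proof -
  define w where "w k = p k / p m" for k
  have w_nonneg: "0 \<le> w k" for k
    using p_nonneg p_pos by (simp add: w_def)
  have w_m: "w m = 1"
    using p_pos by (simp add: w_def)
  have w_less: "w k < 1" if "k \<noteq> m" for k
    using p_max[OF that] p_pos by (simp add: w_def)
  have w_le: "w k \<le> 1" for k
    using w_less[of k] w_m by (cases "k = m") auto
  have summable_w: "summable (\<lambda>k. \<bar>c k\<bar> * w k)"
    using summable_divide[OF summable, of "p m"] by (simp add: w_def)
  have bound: "norm (c k * w k ^ Suc N) \<le> \<bar>c k\<bar> * w k" for k N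
  proof -
    have "w k * w k ^ N \<le> w k * 1"
      using w_nonneg w_le by (intro mult_left_mono power_le_one) auto
    then show ?thesis
      using w_nonneg by (auto simp: abs_mult intro!: mult_left_mono)
  qed
  have limit: "(\<lambda>N. c k * w k ^ Suc N) \<longlonglongrightarrow> (if k = m then c m else 0)" for k
  proof (cases "k = m")
    case False
    then have "(\<lambda>N. w k ^ Suc N) \<longlonglongrightarrow> 0"
      using w_nonneg w_less by (intro LIMSEQ_Suc LIMSEQ_realpow_zero) auto
    then show ?thesis
      using False tendsto_mult_right_zero by fastforce
  qed (simp add: w_m)
  have "(\<lambda>N. \<Sum>k. c k * w k ^ Suc N) \<longlonglongrightarrow> (\<Sum>k. if k = m then c m else 0)"
    using tannerys_theorem[where a = "\<lambda>k N. c k * w k ^ Suc N", OF limit _ summable_w] bound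
    by (simp add: case_prod_unfold)
  moreover have "(\<Sum>k. if k = m then c m else 0) = c m"
    using sums_single[of m "\<lambda>_. c m"] by (simp add: sums_iff)
  moreover have "0 \<le> (\<Sum>k. c k * w k ^ Suc N)" for N
  proof -
    have eq: "c k * p k ^ Suc N = p m ^ Suc N * (c k * w k ^ Suc N)" for k
      using p_pos by (simp add: w_def power_divide)
    have "summable (\<lambda>k. c k * w k ^ Suc N)"
      by (rule summable_comparison_test'[OF summable_w bound])
    then have "0 \<le> p m ^ Suc N * (\<Sum>k. c k * w k ^ Suc N)"
      using nonneg[of "Suc N"] by (simp only: eq suminf_mult zero_less_Suc simp_thms)
    moreover have "0 < p m ^ Suc N"
      using p_pos by (rule zero_less_power)
    ultimately show ?thesis
      using zero_le_mult_iff by (metis not_le)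
  qed
  ultimately show ?thesis
    by (intro LIMSEQ_le_const[where X = "\<lambda>N. \<Sum>k. c k * w k ^ Suc N"]) auto
qed

section \<open>Unimodal weights\<close>

lemma one_plus_less_exp:
  fixes u :: real
  assumes "u \<noteq> 0"
  shows "1 + u < exp u"
proof -
  have "exp u \<noteq> 1 + u"
    using assms ln_eq_minus_one[of "exp u"] by auto
  then show ?thesis
    using exp_ge_add_one_self[of u] by linarith
qed

lemma mult_exp_uminus_less:
  fixes y s :: real
  assumes "0 < s" "y \<noteq> s"
  shows "y * exp (- (y / s)) < s * exp (- 1)"
proof -
  define t where "t = y / s"
  have "t < exp (t - 1)"
    using one_plus_less_exp[of "t - 1"] assms by (simp add: t_def)
  then have "t * exp (- t) < exp (- 1)"
    by (simp add: exp_diff exp_minus field_simps)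
  then have "s * (t * exp (- t)) < s * exp (- 1)"
    using assms by simp
  then show ?thesis
    using assms by (simp add: t_def)
qed

text \<open>
  For \<open>K > 0\<close> and \<open>y = 1 / (K + 1)\<close>, write \<open>x / y = 1 + u\<close> and \<open>(1 - x) / (1 - y) = 1 + v\<close>. This \<open>y\<close> is the
  critical point of \<open>x * (1 - x) ^ K\<close>, which means \<open>u + K v = 0\<close>; so bounding the factors by
  \<open>exp u\<close> and \<open>exp v\<close> bounds the quotient of the two values by \<open>1\<close>.
\<close>

lemma mult_power_one_minus_less:
  fixes x :: real and K :: nat
  defines "y \<equiv> 1 / (real K + 1)"
  assumes "0 \<le> x" "x \<le> 1" "x \<noteq> y"
  shows "x * (1 - x) ^ K < y * (1 - y) ^ K"
proof (cases "K = 0")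
  case True
  then show ?thesis
    using assms by simp
next
  case False
  define u where "u = (real K + 1) * x - 1"
  have y: "0 < y" "0 < 1 - y"
    using False by (auto simp: y_def field_simps)
  have u: "u \<noteq> 0"
    using assms(4) by (auto simp: u_def y_def field_simps)
  have x: "x = y * (1 + u)"
    by (simp add: u_def y_def)
  have one_minus_x: "1 - x = (1 - y) * (1 - u / K)"
  proof -
    have "1 - y = real K * y"
      by (simp add: y_def field_simps)
    then have slope: "(1 - y) / K = y"
      using False by simp
    have "(1 - y) * (1 - u / K) = (1 - y) - (1 - y) / K * u"
      by (simp add: algebra_simps)
    also note slope
    finally show ?thesis
      using x by (simp add: algebra_simps)
  qed
  have "0 \<le> y * (1 + u)" "0 \<le> (1 - y) * (1 - u / K)"
    using assms(2,3) x one_minus_x by simp_all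
  then have pos: "0 \<le> 1 + u" "0 \<le> 1 - u / K"
    using y by (simp_all add: zero_le_mult_iff)
  have "(1 - u / K) ^ K \<le> exp (- u / K) ^ K"
    using exp_ge_add_one_self[of "- u / K"] pos by (intro power_mono) auto
  also have "\<dots> = exp (- u)"
    using False by (simp flip: exp_of_nat_mult)
  finally have "(1 + u) * (1 - u / K) ^ K \<le> (1 + u) * exp (- u)"
    using pos by (intro mult_left_mono) auto
  also have "\<dots> < exp u * exp (- u)"
    using one_plus_less_exp[OF u] by simp
  finally have "(1 + u) * (1 - u / K) ^ K < 1"
    by (simp flip: exp_add)
  then have "y * (1 - y) ^ K * ((1 + u) * (1 - u / K) ^ K) < y * (1 - y) ^ K * 1"
    using y by (intro mult_strict_left_mono) auto
  then show ?thesis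
    unfolding one_minus_x by (subst x) (simp add: power_mult_distrib mult_ac)
qed

section \<open>Sequences that are superpositions of geometric sequences\<close>

lemma summable_geometric_series_differences:
  fixes c x :: "nat \<Rightarrow> real"
  assumes summable: "summable (\<lambda>i. \<bar>c i\<bar>)"
    and x: "\<And>i. 0 \<le> x i" "\<And>i. x i \<le> 1"
  shows "summable (\<lambda>i. c i * (x i ^ j * (1 - x i) ^ k))"
proof (rule summable_comparison_test'[OF summable])
  fix i
  have "x i ^ j * (1 - x i) ^ k \<le> 1 * 1"
    using x[of i] by (intro mult_mono power_le_one) auto
  then show "norm (c i * (x i ^ j * (1 - x i) ^ k)) \<le> \<bar>c i\<bar>"
    using x[of i] by (simp add: abs_mult mult_left_le)
qed

lemma iterated_difference_geometric_series:
  fixes c x :: "nat \<Rightarrow> real"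
  assumes summable: "summable (\<lambda>i. \<bar>c i\<bar>)"
    and x: "\<And>i. 0 \<le> x i" "\<And>i. x i \<le> 1"
  shows "((\<lambda>b n. - forward_diff b n) ^^ k) (\<lambda>n. \<Sum>i. c i * x i ^ n) j =
         (\<Sum>i. c i * (x i ^ j * (1 - x i) ^ k))"
proof (induction k arbitrary: j)
  case 0
  then show ?case by simp
next
  case (Suc k)
  let ?D = "\<lambda>b n. - forward_diff b n" and ?a = "\<lambda>n. \<Sum>i. c i * x i ^ n"
  note sm = summable_geometric_series_differences[of c x, OF summable x]
  have "(\<Sum>i. c i * (x i ^ j * (1 - x i) ^ Suc k)) =
        (\<Sum>i. c i * (x i ^ j * (1 - x i) ^ k) - c i * (x i ^ Suc j * (1 - x i) ^ k))"
    by (simp add: algebra_simps)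
  also have "\<dots> = (\<Sum>i. c i * (x i ^ j * (1 - x i) ^ k)) - (\<Sum>i. c i * (x i ^ Suc j * (1 - x i) ^ k))"
    by (rule suminf_diff[OF sm sm, symmetric])
  finally have "(\<Sum>i. c i * (x i ^ j * (1 - x i) ^ Suc k)) = (?D ^^ k) ?a j - (?D ^^ k) ?a (Suc j)"
    by (simp only: Suc.IH)
  then show ?case
    by (simp add: forward_diff_def)
qed

text \<open>
  The ratios \<open>(1/2) ^ k\<close> are reciprocals of integers, so each of them is the maximum point of
  \<open>x * (1 - x) ^ K\<close> for some natural number \<open>K\<close>.
\<close>

lemma completely_monotone_seq_geometric_series_iff:
  fixes c :: "nat \<Rightarrow> real"
  assumes summable: "summable (\<lambda>k. \<bar>c k\<bar>)"
  shows "completely_monotone_seq (\<lambda>n. \<Sum>k. c k * ((1/2) ^ k) ^ n) \<longleftrightarrow> (\<forall>k. 0 \<le> c k)"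
proof -
  let ?x = "\<lambda>k::nat. (1/2::real) ^ k"
  have x: "0 \<le> ?x k" "?x k \<le> 1" for k
    by (auto simp: power_le_one)
  note diff_eq = iterated_difference_geometric_series[of c ?x, OF summable x]
  show ?thesis
  proof
    assume cm: "completely_monotone_seq (\<lambda>n. \<Sum>k. c k * ((1/2) ^ k) ^ n)"
    show "\<forall>m. 0 \<le> c m"
    proof
      fix m
      define K where "K = (2::nat) ^ m - 1"
      define p where "p k = ?x k * (1 - ?x k) ^ K" for k
      have x_m: "?x m = 1 / (real K + 1)"
        by (simp add: K_def of_nat_diff power_one_over)
      have p_nonneg: "0 \<le> p k" for k
        using x by (simp add: p_def)
      have p_le: "p k \<le> 1 * 1" for k
        unfolding p_def using x[of k] by (intro mult_mono power_le_one) auto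
      show "0 \<le> c m"
      proof (rule coefficient_nonneg_by_localization[where p = p])
        show "summable (\<lambda>k. \<bar>c k\<bar> * p k)"
          using p_nonneg p_le
          by (intro summable_comparison_test'[OF summable]) (simp add: abs_mult mult_left_le)
        show "0 < p m"
          by (cases "m = 0") (auto simp: p_def K_def power_less_one_iff)
        show "p k < p m" if "k \<noteq> m" for k
        proof -
          have "?x k \<noteq> ?x m"
            using that by (simp add: power_inject_exp')
          then show ?thesis
            using mult_power_one_minus_less[of "?x k" K] x[of k] by (simp add: p_def x_m)
        qed
        show "0 \<le> (\<Sum>k. c k * p k ^ N)" for N
          using cm[unfolded completely_monotone_seq_def, rule_format, of "K * N" N]
          by (simp add: diff_eq p_def power_mult power_mult_distrib)
      qed (rule p_nonneg)
    qed
  next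
    assume nonneg: "\<forall>k. 0 \<le> c k"
    show "completely_monotone_seq (\<lambda>n. \<Sum>k. c k * (?x k) ^ n)"
      unfolding completely_monotone_seq_def diff_eq
      using nonneg x
      by (intro allI suminf_nonneg summable_geometric_series_differences[OF summable] mult_nonneg_nonneg
          zero_le_power) auto
  qed
qed

section \<open>Functions that are power series in \<open>exp (- x)\<close>\<close>

lemma summable_power_series_times_index:
  fixes c :: "nat \<Rightarrow> real"
  assumes "\<And>t. \<bar>t\<bar> < 1 \<Longrightarrow> summable (\<lambda>k. c k * t ^ k)" and "\<bar>t\<bar> < 1"
  shows "summable (\<lambda>k. real k * c k * t ^ k)"
proof -
  have "summable (\<lambda>k. diffs c k * t ^ k)"
    using assms by (intro termdiff_converges[where K = 1]) auto
  then have "summable (\<lambda>k. t * (real k * c k * t ^ (k - Suc 0)))"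
    by (intro summable_mult) (rule sums_summable[OF diffs_equiv])
  moreover have "t * (real k * c k * t ^ (k - Suc 0)) = real k * c k * t ^ k" for k
    by (cases k) auto
  ultimately show ?thesis
    by simp
qed

lemma has_field_derivative_exp_series:
  fixes c :: "nat \<Rightarrow> real"
  assumes c: "\<And>t. \<bar>t\<bar> < 1 \<Longrightarrow> summable (\<lambda>k. c k * t ^ k)" and "0 < x"
  shows "((\<lambda>x. \<Sum>k. c k * exp (- x) ^ k) has_field_derivative
          - (\<Sum>k. real k * c k * exp (- x) ^ k)) (at x)"
proof -
  let ?t = "exp (- x)"
  have t: "\<bar>?t\<bar> < 1"
    using assms by simp
  have "summable (\<lambda>k. diffs c k * ?t ^ k)"
    using assms t by (intro termdiff_converges[where K = 1]) auto
  then have "(\<lambda>k. ?t * (real k * c k * ?t ^ (k - Suc 0))) sums (?t * (\<Sum>k. diffs c k * ?t ^ k))"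
    by (intro sums_mult diffs_equiv)
  moreover have "?t * (real k * c k * ?t ^ (k - Suc 0)) = real k * c k * ?t ^ k" for k
    by (cases k) auto
  ultimately have series: "(\<Sum>k. real k * c k * ?t ^ k) = ?t * (\<Sum>k. diffs c k * ?t ^ k)"
    by (simp add: sums_iff)
  have "((\<lambda>t. \<Sum>k. c k * t ^ k) has_field_derivative (\<Sum>k. diffs c k * ?t ^ k)) (at ?t)"
    using c t by (intro termdiffs_strong'[where K = 1]) auto
  moreover have "((\<lambda>x. exp (- x)) has_field_derivative - ?t) (at x)"
    by (auto intro!: derivative_eq_intros)
  ultimately have "((\<lambda>x. \<Sum>k. c k * exp (- x) ^ k) has_field_derivative
                    (\<Sum>k. diffs c k * ?t ^ k) * - ?t) (at x)"
    by (rule DERIV_chain2)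
  then show ?thesis
    unfolding series by (simp add: mult.commute)
qed

context
  fixes c :: "nat \<Rightarrow> real" and g :: "real \<Rightarrow> real"
  assumes c: "\<And>t. \<bar>t\<bar> < 1 \<Longrightarrow> summable (\<lambda>k. c k * t ^ k)"
    and g: "\<And>x. 0 < x \<Longrightarrow> g x = (\<Sum>k. c k * exp (- x) ^ k)"
begin

lemma summable_exp_series_moment:
  assumes "\<bar>t\<bar> < 1"
  shows "summable (\<lambda>k. real k ^ n * c k * t ^ k)"
  using assms
proof (induction n arbitrary: t)
  case (Suc n)
  then show ?case
    using summable_power_series_times_index[of "\<lambda>k. real k ^ n * c k" t] by (simp add: mult_ac)
qed (use c in simp)

text \<open>
  The function \<open>h\<close> stands for an iterated derivative of \<open>g\<close>, whose values are known on the
  positive half-line only; the factor \<open>s\<close> absorbs its sign.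
\<close>

lemma has_field_derivative_exp_series_moment:
  assumes h: "\<And>x. 0 < x \<Longrightarrow> h x = s * (\<Sum>k. real k ^ n * c k * exp (- x) ^ k)" and "0 < x"
  shows "(h has_field_derivative - s * (\<Sum>k. real k ^ Suc n * c k * exp (- x) ^ k)) (at x)"
proof (rule has_field_derivative_transform_within_open[where S = "{0<..}"])
  have "((\<lambda>x. \<Sum>k. real k ^ n * c k * exp (- x) ^ k) has_field_derivative
         - (\<Sum>k. real k * (real k ^ n * c k) * exp (- x) ^ k)) (at x)"
    using summable_exp_series_moment \<open>0 < x\<close> by (intro has_field_derivative_exp_series) auto
  then have "((\<lambda>x. s * (\<Sum>k. real k ^ n * c k * exp (- x) ^ k)) has_field_derivative
              s * - (\<Sum>k. real k * (real k ^ n * c k) * exp (- x) ^ k)) (at x)"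
    by (rule DERIV_cmult)
  then show "((\<lambda>x. s * (\<Sum>k. real k ^ n * c k * exp (- x) ^ k)) has_field_derivative
         - s * (\<Sum>k. real k ^ Suc n * c k * exp (- x) ^ k)) (at x)"
    by (simp add: mult_ac)
qed (use assms in auto)

lemma iterated_deriv_exp_series:
  assumes "0 < x"
  shows "(deriv ^^ n) g x = (- 1) ^ n * (\<Sum>k. real k ^ n * c k * exp (- x) ^ k)"
  using assms
proof (induction n arbitrary: x)
  case (Suc n)
  show ?case
    using DERIV_imp_deriv[OF has_field_derivative_exp_series_moment[OF Suc.IH Suc.prems]] by simp
qed (use g in simp)

lemma iterated_neg_deriv_exp_series:
  assumes "0 < x"
  shows "((\<lambda>h x. - deriv h x) ^^ n) g x = (\<Sum>k. real k ^ n * c k * exp (- x) ^ k)"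
  using assms
proof (induction n arbitrary: x)
  case (Suc n)
  show ?case
    using DERIV_imp_deriv[OF has_field_derivative_exp_series_moment[where s = 1 and n = n, OF _ Suc.prems]]
      Suc.IH by simp
qed (use g in simp)

text \<open>
  For \<open>m > 0\<close> the index \<open>m\<close> is isolated by \<open>N\<close> derivatives at \<open>x = N / m\<close>: the resulting weight
  \<open>k ^ N * exp (- k N / m)\<close> is the \<open>N\<close>-th power of \<open>k * exp (- k / m)\<close>. The index \<open>0\<close> carries
  the limit at infinity and is isolated by the values of the function at \<open>x = N\<close>.
\<close>

lemma completely_monotone_fun_exp_series_iff:
  "completely_monotone_fun g \<longleftrightarrow> (\<forall>k. 0 \<le> c k)"
proof
  assume cm: "completely_monotone_fun g"
  have nonneg: "0 \<le> (\<Sum>k. real k ^ n * c k * exp (- x) ^ k)" if "0 < x" for n x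
    using cm that iterated_neg_deriv_exp_series[OF that, of n]
    unfolding completely_monotone_fun_def by metis
  have summable: "summable (\<lambda>k. \<bar>c k\<bar> * (real k ^ n * exp (- x) ^ k))" if "0 < x" for x n
  proof -
    \<comment> \<open>Convergence at the larger point \<open>exp (- x / 2)\<close> makes the convergence absolute.\<close>
    have "summable (\<lambda>k. norm (real k ^ n * c k * exp (- x) ^ k))"
      using that by (intro powser_insidea[where x = "exp (- x / 2)"] summable_exp_series_moment) auto
    then show ?thesis
      by (simp add: abs_mult mult_ac)
  qed
  show "\<forall>m. 0 \<le> c m"
  proof
    fix m
    show "0 \<le> c m"
    proof (cases "m = 0")
      case True
      show ?thesis
      proof (rule coefficient_nonneg_by_localization[where p = "\<lambda>k. exp (- 1) ^ k"])
        show "summable (\<lambda>k. \<bar>c k\<bar> * exp (- 1) ^ k)"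
          using summable[of 1 0] by simp
        show "exp (- 1) ^ k < (exp (- 1) ^ m :: real)" if "k \<noteq> m" for k
          using that True by (simp add: power_less_one_iff)
        show "0 \<le> (\<Sum>k. c k * (exp (- 1) ^ k) ^ N)" if "0 < N" for N
          using nonneg[of "real N" 0] that
          by (simp add: mult.commute flip: exp_of_nat_mult)
      qed auto
    next
      case False
      define p where "p k = real k * exp (- (1 / m)) ^ k" for k
      have p_eq: "p k = real k * exp (- (real k / m))" for k
        by (simp add: p_def flip: exp_of_nat_mult)
      show ?thesis
      proof (rule coefficient_nonneg_by_localization[where p = p])
        show "summable (\<lambda>k. \<bar>c k\<bar> * p k)"
          using summable[of "1 / m" 1] False by (simp add: p_def)
        show "p k < p m" if "k \<noteq> m" for k
          using mult_exp_uminus_less[of "real m" "real k"] that False by (simp add: p_eq)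
        show "0 \<le> (\<Sum>k. c k * p k ^ N)" if "0 < N" for N
        proof -
          have "c k * p k ^ N = real k ^ N * c k * exp (- (N / m)) ^ k" for k
            by (simp add: p_eq power_mult_distrib mult_ac flip: exp_of_nat_mult)
          then show ?thesis
            using nonneg[of "N / m" N] that False by (simp only: zero_less_divide_iff of_nat_0_less_iff neq0_conv) simp
        qed
      qed (use False in \<open>auto simp: p_def\<close>)
    qed
  qed
next
  assume nonneg: "\<forall>k. 0 \<le> c k"
  have "(deriv ^^ n) g field_differentiable at x" if "0 < x" for n x
    using has_field_derivative_exp_series_moment[OF iterated_deriv_exp_series that]
    by (auto simp: field_differentiable_def)
  moreover have "0 \<le> ((\<lambda>h x. - deriv h x) ^^ n) g x" if "0 < x" for n x
    unfolding iterated_neg_deriv_exp_series[OF that]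
    using that nonneg by (intro suminf_nonneg summable_exp_series_moment) auto
  ultimately show "completely_monotone_fun g"
    by (auto simp: completely_monotone_fun_def)
qed

end

section \<open>Signs of generalised binomial coefficients\<close>

text \<open>
  For \<open>\<alpha> \<notin> \<nat>\<close> the negative coefficient is the one with index \<open>\<lfloor>\<alpha>\<rfloor> + 2\<close>: in its falling product
  the factors \<open>\<alpha>, \<dots>, \<alpha> - \<lfloor>\<alpha>\<rfloor>\<close> are positive and the last factor \<open>\<alpha> - \<lfloor>\<alpha>\<rfloor> - 1\<close> is negative.
\<close>

lemma all_gbinomial_nonneg_iff:
  fixes \<alpha> :: real
  assumes "0 < \<alpha>"
  shows "(\<forall>k. 0 \<le> \<alpha> gchoose k) \<longleftrightarrow> \<alpha> \<in> \<nat>"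
proof
  assume "\<alpha> \<in> \<nat>"
  then show "\<forall>k. 0 \<le> \<alpha> gchoose k"
    by (auto elim!: Nats_cases simp flip: binomial_gbinomial)
next
  assume nonneg: "\<forall>k. 0 \<le> \<alpha> gchoose k"
  show "\<alpha> \<in> \<nat>"
  proof (rule ccontr)
    assume "\<alpha> \<notin> \<nat>"
    define l where "l = nat \<lfloor>\<alpha>\<rfloor>"
    have "real l \<le> \<alpha>" "\<alpha> < real l + 1"
      using assms by (auto simp: l_def)
    moreover have "\<alpha> \<noteq> real l"
      using \<open>\<alpha> \<notin> \<nat>\<close> by auto
    ultimately have l: "real l < \<alpha>" "\<alpha> < real l + 1"
      by auto
    have "0 < (\<Prod>i = 0..<Suc l. \<alpha> - real i)"
      using l by (intro prod_pos) auto
    then have "(\<Prod>i = 0..<Suc (Suc l). \<alpha> - real i) < 0"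
      using l by (subst prod.atLeast0_lessThan_Suc) (simp add: mult_pos_neg)
    then have "\<alpha> gchoose Suc (Suc l) < 0"
      unfolding gbinomial_prod_rev by (intro divide_neg_pos) auto
    then show False
      using nonneg by (meson not_le)
  qed
qed

section \<open>Powers of \<open>1 + (1/2) ^ (n + 1)\<close> and of \<open>1 + exp (- x)\<close>\<close>

text \<open>
  The exponent is \<open>Suc n\<close> rather than \<open>n\<close> so that the binomial series is evaluated inside its
  disc of convergence also for \<open>n = 0\<close>.
\<close>

lemma completely_monotone_seq_powr_iff:
  fixes \<alpha> :: real
  assumes "0 < \<alpha>"
  shows "completely_monotone_seq (\<lambda>n. (1 + (1/2) ^ Suc n) powr \<alpha>) \<longleftrightarrow> \<alpha> \<in> \<nat>"
proof -
  let ?c = "\<lambda>k. (\<alpha> gchoose k) * (1/2) ^ k"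
  \<comment> \<open>Convergence at any point between \<open>1/2\<close> and \<open>1\<close> gives absolute convergence at \<open>1/2\<close>.\<close>
  have "summable (\<lambda>k. (\<alpha> gchoose k) * (3/4) ^ k)"
    by (rule sums_summable[OF gen_binomial_real]) simp
  then have "summable (\<lambda>k. norm (?c k))"
    by (rule powser_insidea) simp
  then have summable: "summable (\<lambda>k. \<bar>?c k\<bar>)"
    by simp
  have "(1 + (1/2) ^ Suc n) powr \<alpha> = (\<Sum>k. ?c k * ((1/2) ^ k) ^ n)" for n
  proof -
    have "\<bar>(1/2) ^ Suc n\<bar> < (1::real)"
      by (simp add: power_less_one_iff flip: power_Suc)
    then have "(1 + (1/2) ^ Suc n) powr \<alpha> = (\<Sum>k. (\<alpha> gchoose k) * ((1/2) ^ Suc n) ^ k)"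
      by (intro sums_unique gen_binomial_real)
    moreover have "((1/2::real) ^ Suc n) ^ k = (1/2) ^ k * ((1/2) ^ k) ^ n" for k
    proof -
      have "Suc n * k = k + k * n"
        by simp
      then show ?thesis
        by (simp only: power_add flip: power_mult)
    qed
    ultimately show ?thesis
      by (simp only: mult.assoc)
  qed
  then have "completely_monotone_seq (\<lambda>n. (1 + (1/2) ^ Suc n) powr \<alpha>) \<longleftrightarrow> (\<forall>k. 0 \<le> ?c k)"
    using completely_monotone_seq_geometric_series_iff[OF summable] by presburger
  also have "\<dots> \<longleftrightarrow> (\<forall>k. 0 \<le> \<alpha> gchoose k)"
    by (simp add: zero_le_mult_iff power_le_zero_eq)
  also have "\<dots> \<longleftrightarrow> \<alpha> \<in> \<nat>"
    by (rule all_gbinomial_nonneg_iff[OF assms])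
  finally show ?thesis .
qed

lemma completely_monotone_fun_powr_iff:
  fixes \<alpha> :: real
  assumes "0 < \<alpha>"
  shows "completely_monotone_fun (\<lambda>x. (1 + exp (- x)) powr \<alpha>) \<longleftrightarrow> \<alpha> \<in> \<nat>"
proof -
  have "completely_monotone_fun (\<lambda>x. (1 + exp (- x)) powr \<alpha>) \<longleftrightarrow> (\<forall>k. 0 \<le> \<alpha> gchoose k)"
  proof (rule completely_monotone_fun_exp_series_iff)
    show "summable (\<lambda>k. (\<alpha> gchoose k) * t ^ k)" if "\<bar>t\<bar> < 1" for t
      using sums_summable[OF gen_binomial_real[OF that]] .
    show "(1 + exp (- x)) powr \<alpha> = (\<Sum>k. (\<alpha> gchoose k) * exp (- x) ^ k)" if "0 < x" for x
      using that by (intro sums_unique gen_binomial_real) auto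
  qed
  also have "\<dots> \<longleftrightarrow> \<alpha> \<in> \<nat>"
    by (rule all_gbinomial_nonneg_iff[OF assms])
  finally show ?thesis .
qed

theorem theorem12:
  shows "(\<exists>f :: nat \<Rightarrow> real. (\<forall>n. f n \<ge> 0) \<and> completely_monotone_seq f \<and>
            (\<forall>\<alpha>::real. \<alpha> > 0 \<longrightarrow>
               (completely_monotone_seq (\<lambda>n. f n powr \<alpha>) \<longleftrightarrow> \<alpha> \<in> \<nat>))) \<and>
         (\<exists>g :: real \<Rightarrow> real. (\<forall>x>0. g x \<ge> 0) \<and> completely_monotone_fun g \<and>
            (\<forall>\<alpha>::real. \<alpha> > 0 \<longrightarrow>
               (completely_monotone_fun (\<lambda>x. g x powr \<alpha>) \<longleftrightarrow> \<alpha> \<in> \<nat>)))"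
proof (intro conjI exI)
  \<comment> \<open>The witnesses themselves are the case \<open>\<alpha> = 1\<close>.\<close>
  show "completely_monotone_seq (\<lambda>n. 1 + (1/2) ^ Suc n)"
    using completely_monotone_seq_powr_iff[of 1] by simp
  show "completely_monotone_fun (\<lambda>x. 1 + exp (- x))"
    using completely_monotone_fun_powr_iff[of 1] by simp
qed (use completely_monotone_seq_powr_iff completely_monotone_fun_powr_iff in \<open>auto simp: add_nonneg_nonneg\<close>)

end
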